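(* Let $X\in\mathcal{X}$, let $\Pi\subseteq\mathcal{X}\setminus\{X\}$ with $\Pi\neq\emptyset$ be a parent set for $X$, and let $\Pi_0=\Pi\cup\{Y_0\}$ for some $Y_0\in\mathcal{X}\setminus(\Pi\cup\{X\})$. Let $Y'$ be a maximizer of $w(X,Y)+\mathrm{Pen}(X,\Pi\cup\{Y\})$ over $Y\in\mathcal{X}\setminus(\Pi_0\cup\{X\})$. Suppose that $$w(X,Y_0)+\mathrm{Pen}(X,\Pi_0)\le \mathrm{Pen}(X,\Pi)$$ and $$w(X,Y')+\mathrm{Pen}(X,\Pi\cup\{Y'\})\le 0$$ (the second condition being void if $\mathcal{X}\setminus(\Pi_0\cup\{X\})=\emptyset$). Then $\Pi_0$ and any of its supersets are not optimal parent sets for $X$, in the sense that for every $\Pi'$ with $\Pi_0\subseteq\Pi'\subseteq\mathcal{X}\setminus\{X\}$ the strictly smaller parent set $\Pi\subset\Pi'$ satisfies $\mathrm{BIC}(X,\Pi')\le\mathrm{BIC}(X,\Pi)$.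
   Context: $\mathcal{X}=\{X_1,\dots,X_n\}$ is a finite set of categorical random variables (also called nodes), each with a finite number of states, at least two. $\mathcal{D}$ is a complete data set of $N\ge 1$ instances, each assigning a state to every variable. A parent set for $X\in\mathcal{X}$ is a subset of $\mathcal{X}\setminus\{X\}$. $|X|$ denotes the number of states of $X$, and for a set $\Pi$ of variables $|\Pi|$ denotes the product of the numbers of states of its elements (the size of the joint state space, with $|\emptyset|=1$), not its cardinality. For a joint state $\pi$ of $\Pi$ and a state $x$ of $X$, $N_{x,\pi}$ is the number of instances with $X=x$ and $\Pi=\pi$, $N_\pi=\sum_x N_{x,\pi}$, and $\hat\theta_{x|\pi}=N_{x,\pi}/N_\pi$ is the maximum likelihood estimate. With the convention $0\log 0=0$ (terms with $N_{x,\pi}=0$ contribute $0$), define $$\mathrm{LL}(X|\Pi)=\sum_{\pi}\sum_{x}N_{x,\pi}\log\hat\theta_{x|\pi},\qquad \mathrm{LL}(X)=\mathrm{LL}(X|\emptyset)=\sum_x N_x\log (N_x/N),$$ $$\mathrm{Pen}(X,\Pi)=-\frac{\log N}{2}(|X|-1)\,|\Pi|,\qquad \mathrm{BIC}(X,\Pi)=\mathrm{LL}(X|\Pi)+\mathrm{Pen}(X,\Pi).$$ For distinct $X,Y\in\mathcal{X}$ write $\mathrm{LL}(X|Y)=\mathrm{LL}(X|\{Y\})$, and define $\mathrm{MI}(X,Y)=\mathrm{LL}(X|Y)-\mathrm{LL}(X)$ and $$w(X,Y)=\mathrm{MI}(X,Y)-\max\{\mathrm{LL}(X);\mathrm{LL}(Y)\}.$$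 *)

theory Defs
  imports Complex_Main "HOL-Library.FuncSet"
begin

text \<open>
  The variables are the elements of a set of type \<^typ>\<open>'v set\<close>, and \<open>S X\<close> is the set of states of
  the variable \<open>X\<close>. A data set \<open>D\<close> is a list of instances, each a function from variables to states,
  so \<open>N\<close> is \<open>length D\<close>. The joint states of a set \<open>P\<close> of variables are the elements of \<open>PiE P S\<close>.
\<close>

definition joint_size :: "('v \<Rightarrow> 's set) \<Rightarrow> 'v set \<Rightarrow> nat" where
  "joint_size S P = (\<Prod>Y\<in>P. card (S Y))"

definition joint_count :: "('v \<Rightarrow> 's) list \<Rightarrow> 'v \<Rightarrow> 'v set \<Rightarrow> 's \<Rightarrow> ('v \<Rightarrow> 's) \<Rightarrow> nat" where
  "joint_count D X P x p = length (filter (\<lambda>d. d X = x \<and> (\<forall>Y\<in>P. d Y = p Y)) D)"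

definition parent_count ::
    "('v \<Rightarrow> 's set) \<Rightarrow> ('v \<Rightarrow> 's) list \<Rightarrow> 'v \<Rightarrow> 'v set \<Rightarrow> ('v \<Rightarrow> 's) \<Rightarrow> nat" where
  "parent_count S D X P p = (\<Sum>x\<in>S X. joint_count D X P x p)"

definition mle ::
    "('v \<Rightarrow> 's set) \<Rightarrow> ('v \<Rightarrow> 's) list \<Rightarrow> 'v \<Rightarrow> 'v set \<Rightarrow> 's \<Rightarrow> ('v \<Rightarrow> 's) \<Rightarrow> real" where
  "mle S D X P x p = real (joint_count D X P x p) / real (parent_count S D X P p)"

text \<open>Terms with a zero count vanish because of the factor \<^const>\<open>joint_count\<close>, whatever the value of
  the logarithm; this is the convention \<open>0 log 0 = 0\<close>.\<close>

definition LL :: "('v \<Rightarrow> 's set) \<Rightarrow> ('v \<Rightarrow> 's) list \<Rightarrow> 'v \<Rightarrow> 'v set \<Rightarrow> real" where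
  "LL S D X P = (\<Sum>p\<in>PiE P S. \<Sum>x\<in>S X. real (joint_count D X P x p) * ln (mle S D X P x p))"

definition Pen :: "('v \<Rightarrow> 's set) \<Rightarrow> ('v \<Rightarrow> 's) list \<Rightarrow> 'v \<Rightarrow> 'v set \<Rightarrow> real" where
  "Pen S D X P = - (ln (real (length D)) / 2) * (real (card (S X)) - 1) * real (joint_size S P)"

definition BIC :: "('v \<Rightarrow> 's set) \<Rightarrow> ('v \<Rightarrow> 's) list \<Rightarrow> 'v \<Rightarrow> 'v set \<Rightarrow> real" where
  "BIC S D X P = LL S D X P + Pen S D X P"

definition MI :: "('v \<Rightarrow> 's set) \<Rightarrow> ('v \<Rightarrow> 's) list \<Rightarrow> 'v \<Rightarrow> 'v \<Rightarrow> real" where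
  "MI S D X Y = LL S D X {Y} - LL S D X {}"

definition w_score :: "('v \<Rightarrow> 's set) \<Rightarrow> ('v \<Rightarrow> 's) list \<Rightarrow> 'v \<Rightarrow> 'v \<Rightarrow> real" where
  "w_score S D X Y = MI S D X Y - max (LL S D X {}) (LL S D Y {})"

text \<open>The marginal log-likelihood \<open>LL(X)\<close> is \<open>LL S D X {}\<close>.\<close>

lemma sum_length_filter_eq:
  assumes "finite A" and "\<forall>d\<in>set D. f d \<in> A"
  shows "(\<Sum>x\<in>A. length (filter (\<lambda>d. f d = x) D)) = length D"
  using assms(2)
proof (induction D)
  case (Cons d D)
  have "(\<Sum>x\<in>A. length (filter (\<lambda>d. f d = x) (d # D)))
      = (\<Sum>x\<in>A. (if f d = x then 1 else 0) + length (filter (\<lambda>d. f d = x) D))"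
    by (rule sum.cong) auto
  then show ?case
    using Cons assms(1) by (simp add: sum.distrib)
qed simp

lemma LL_empty:
  assumes "finite (S X)" and "\<forall>d\<in>set D. d X \<in> S X"
  shows "LL S D X {} = (\<Sum>x\<in>S X. real (length (filter (\<lambda>d. d X = x) D))
           * ln (real (length (filter (\<lambda>d. d X = x) D)) / real (length D)))"
  using sum_length_filter_eq[of "S X" D "\<lambda>d. d X"] assms
  by (simp add: LL_def mle_def parent_count_def joint_count_def)

end

theory Submission imports Defs
begin

text \<open>
  Written as a sum over the instances, \<open>LL(X|\<Pi>)\<close> is \<open>-N H(X|\<Pi>)\<close> for the empirical entropy \<open>H\<close>. Adding
  one parent \<open>Y\<close> to any set \<open>Q\<close> gains \<open>N I(X;Y|Q)\<close>, which is at most \<open>N H(X|Q) \<le> N H(X)\<close> and at most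
  \<open>N H(Y|Q) \<le> N H(Y)\<close>, hence at most \<open>w(X,Y)\<close> because \<open>MI(X,Y) \<ge> 0\<close>. Adding the elements of \<open>\<Pi>' - \<Pi>\<close>
  one after the other, the total gain is bounded by the sum of the \<open>w(X,Y)\<close>. The hypotheses bound this
  sum by \<open>Pen(X,\<Pi>)\<close> minus the sum of the \<open>Pen(X,\<Pi> \<union> {Y})\<close>, which is at most \<open>Pen(X,\<Pi>) - Pen(X,\<Pi>')\<close>
  because numbers that are at least 2 have a sum that is at most their product.
\<close>

section \<open>Counts and likelihoods as sums over instances\<close>

text \<open>The reference point \<open>d\<close> will be an instance of \<open>D\<close> itself. It
  lies in its own class, so every count appearing in a logarithm or denominator is positive.\<close>

definition agree :: "('v \<Rightarrow> 's) list \<Rightarrow> 'v set \<Rightarrow> ('v \<Rightarrow> 's) \<Rightarrow> nat" where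
  "agree D Q d = length (filter (\<lambda>e. \<forall>Z\<in>Q. e Z = d Z) D)"

lemma agree_empty [simp]: "agree D {} d = length D"
  by (simp add: agree_def)

lemma agree_pos: "d \<in> set D \<Longrightarrow> agree D Q d > 0"
  by (auto simp: agree_def filter_empty_conv)

lemma agree_antimono: "Q \<subseteq> R \<Longrightarrow> agree D R d \<le> agree D Q d"
  unfolding agree_def length_filter_conv_card by (rule card_mono) auto

text \<open>The sum runs over indices because \<open>D\<close> may contain the same instance several
  times. In this form a product of two counts becomes a double sum.\<close>

lemma agree_eq_sum:
  "real (agree D Q d) = (\<Sum>i<length D. of_bool (\<forall>Z\<in>Q. (D ! i) Z = d Z))"
proof -
  have "{i. i < length D \<and> (\<forall>Z\<in>Q. (D ! i) Z = d Z)} = {..<length D} \<inter> {i. \<forall>Z\<in>Q. (D ! i) Z = d Z}"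
    by auto
  then show ?thesis
    by (simp add: agree_def length_filter_conv_card)
qed

lemma parent_count_eq_agree:
  assumes "finite (S X)" and "\<forall>d\<in>set D. d X \<in> S X"
  shows "parent_count S D X P p = agree D P p"
proof -
  have "parent_count S D X P p =
      (\<Sum>x\<in>S X. length (filter (\<lambda>d. d X = x) (filter (\<lambda>d. \<forall>Y\<in>P. d Y = p Y) D)))"
    by (simp add: parent_count_def joint_count_def conj_commute)
  also have "\<dots> = length (filter (\<lambda>d. \<forall>Y\<in>P. d Y = p Y) D)"
    by (rule sum_length_filter_eq) (use assms in auto)
  finally show ?thesis
    by (simp add: agree_def)
qed

text \<open>Each instance \<open>d\<close> is counted at exactly one pair of states,
  \<open>d X\<close> and \<open>restrict d P\<close>, so weighting by the counts amounts to summing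
  over the instances.\<close>

lemma sum_joint_count:
  fixes f :: "'s \<Rightarrow> ('v \<Rightarrow> 's) \<Rightarrow> real"
  assumes "finite P" and "finite (S X)" and "\<forall>Y\<in>P. finite (S Y)"
    and "\<forall>d\<in>set D. d X \<in> S X \<and> (\<forall>Y\<in>P. d Y \<in> S Y)"
  shows "(\<Sum>p\<in>PiE P S. \<Sum>x\<in>S X. real (joint_count D X P x p) * f x p)
    = (\<Sum>d\<leftarrow>D. f (d X) (restrict d P))"
  using assms(4)
proof (induction D)
  case Nil
  then show ?case by (simp add: joint_count_def)
next
  case (Cons d D)
  have fin: "finite (PiE P S)"
    using assms by (intro finite_PiE) auto
  have mem: "restrict d P \<in> PiE P S" "d X \<in> S X"
    using Cons.prems by auto
  \<comment> \<open>Elements of \<open>PiE P S\<close> are fixed outside \<open>P\<close>, so their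
    values on \<open>P\<close> determine them.\<close>
  have eq: "(\<forall>Y\<in>P. d Y = p Y) \<longleftrightarrow> p = restrict d P" if "p \<in> PiE P S" for p
    using that by (auto simp: PiE_def extensional_def restrict_def fun_eq_iff)
  have "(\<Sum>p\<in>PiE P S. \<Sum>x\<in>S X. real (joint_count (d # D) X P x p) * f x p)
      = (\<Sum>p\<in>PiE P S. \<Sum>x\<in>S X. (if p = restrict d P then if x = d X then f x p else 0 else 0)
          + real (joint_count D X P x p) * f x p)"
    by (intro sum.cong refl) (auto simp: joint_count_def eq algebra_simps)
  also have "\<dots> = (\<Sum>p\<in>PiE P S. \<Sum>x\<in>S X. (if p = restrict d P then if x = d X then f x p else 0 else 0))
      + (\<Sum>p\<in>PiE P S. \<Sum>x\<in>S X. real (joint_count D X P x p) * f x p)"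
    by (simp add: sum.distrib)
  also have "(\<Sum>p\<in>PiE P S. \<Sum>x\<in>S X. (if p = restrict d P then if x = d X then f x p else 0 else 0))
      = (\<Sum>p\<in>PiE P S. if p = restrict d P then f (d X) p else 0)"
    using mem assms by (intro sum.cong refl) auto
  also have "\<dots> = f (d X) (restrict d P)"
    using mem fin by simp
  finally show ?case
    using Cons.IH Cons.prems by (simp del: restrict_apply)
qed

locale data_set =
  fixes V :: "'v set" and S :: "'v \<Rightarrow> 's set" and D :: "('v \<Rightarrow> 's) list"
  assumes finite_V: "finite V"
    and finite_states: "Z \<in> V \<Longrightarrow> finite (S Z)"
    and states: "d \<in> set D \<Longrightarrow> Z \<in> V \<Longrightarrow> d Z \<in> S Z"
begin

lemma LL_eq:
  assumes "X \<in> V" and "P \<subseteq> V"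
  shows "LL S D X P = (\<Sum>d\<leftarrow>D. ln (real (agree D (insert X P) d) / real (agree D P d)))"
proof -
  have "finite P"
    using assms finite_V finite_subset by blast
  then have "LL S D X P = (\<Sum>d\<leftarrow>D. ln (mle S D X P (d X) (restrict d P)))"
    unfolding LL_def using assms finite_states states by (intro sum_joint_count) auto
  also have "\<dots> = (\<Sum>d\<leftarrow>D. ln (real (agree D (insert X P) d) / real (agree D P d)))"
  proof -
    have "mle S D X P (d X) (restrict d P) = real (agree D (insert X P) d) / real (agree D P d)" for d
      using assms finite_states states
      by (simp add: mle_def parent_count_eq_agree) (simp add: joint_count_def agree_def)
    then show ?thesis by simp
  qed
  finally show ?thesis .
qed

section \<open>Entropy inequalities\<close>

lemma LL_nonpos:
  assumes "X \<in> V" and "P \<subseteq> V"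
  shows "LL S D X P \<le> 0"
proof -
  have "ln (real (agree D (insert X P) d) / real (agree D P d)) \<le> 0" if "d \<in> set D" for d
    using agree_pos[OF that, of P] agree_pos[OF that, of "insert X P"]
      agree_antimono[of P "insert X P" D d] by (simp add: subset_insertI)
  then show ?thesis
    unfolding LL_eq[OF assms] by (intro sum_list_nonpos) auto
qed

text \<open>For fixed \<open>a\<close> and \<open>b\<close>, the instances that agree with \<open>a\<close> on \<open>P\<close> and with \<open>b\<close> at \<open>X\<close> form a single
  class of the relation counted by \<open>agree D (insert X P)\<close>, so their contributions sum to at most 1.\<close>

lemma sum_agree_ratio_le:
  "(\<Sum>i<length D. real (agree D P (D ! i)) * real (agree D {X} (D ! i)) / real (agree D (insert X P) (D ! i)))
    \<le> (real (length D))\<^sup>2"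
proof -
  let ?n = "length D"
  define A where "A a b = {i. i < ?n \<and> (\<forall>Z\<in>P. (D ! a) Z = (D ! i) Z) \<and> (D ! b) X = (D ! i) X}" for a b
  \<comment> \<open>Expanding both counts makes the numerator the number of index pairs
    \<open>(a, b)\<close> with \<open>i\<close> in \<open>A a b\<close>. After exchanging sums, each
    of the \<open>?n * ?n\<close> pairs contributes at most 1.\<close>
  have ratio: "real (agree D P (D ! i)) * real (agree D {X} (D ! i)) / real (agree D (insert X P) (D ! i))
      = (\<Sum>a<?n. \<Sum>b<?n. of_bool (i \<in> A a b) / real (agree D (insert X P) (D ! i)))" if "i < ?n" for i
  proof -
    have "real (agree D P (D ! i)) * real (agree D {X} (D ! i)) = (\<Sum>a<?n. \<Sum>b<?n. of_bool (i \<in> A a b))"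
      unfolding agree_eq_sum sum_product using that
      by (intro sum.cong refl) (auto simp: A_def)
    then show ?thesis
      by (simp only: sum_divide_distrib)
  qed
  have inner: "(\<Sum>i<?n. of_bool (i \<in> A a b) / real (agree D (insert X P) (D ! i))) \<le> 1" for a b
  proof -
    have "agree D (insert X P) (D ! i) = card (A a b)" if "i \<in> A a b" for i
      unfolding agree_def length_filter_conv_card
      by (rule arg_cong[of _ _ card]) (use that in \<open>auto simp: A_def\<close>)
    then have "(\<Sum>i<?n. of_bool (i \<in> A a b) / real (agree D (insert X P) (D ! i)))
        = (\<Sum>i<?n. of_bool (i \<in> A a b) / real (card (A a b)))"
      by (intro sum.cong refl) auto
    also have "\<dots> = (\<Sum>i<?n. of_bool (i \<in> A a b)) / real (card (A a b))"
      by (simp only: sum_divide_distrib)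
    also have "(\<Sum>i<?n. of_bool (i \<in> A a b)) = real (card (A a b))"
    proof -
      have "{..<?n} \<inter> A a b = A a b"
        by (auto simp: A_def)
      then show ?thesis by simp
    qed
    finally show ?thesis
      \<comment> \<open>The quotient is 0 for an empty class, by the convention
        \<open>x / 0 = 0\<close>, and 1 otherwise.\<close>
      by (cases "card (A a b) = 0") auto
  qed
  have "(\<Sum>i<?n. real (agree D P (D ! i)) * real (agree D {X} (D ! i)) / real (agree D (insert X P) (D ! i)))
      = (\<Sum>i<?n. \<Sum>a<?n. \<Sum>b<?n. of_bool (i \<in> A a b) / real (agree D (insert X P) (D ! i)))"
    by (intro sum.cong refl ratio) auto
  also have "\<dots> = (\<Sum>a<?n. \<Sum>i<?n. \<Sum>b<?n. of_bool (i \<in> A a b) / real (agree D (insert X P) (D ! i)))"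
    by (rule sum.swap)
  also have "\<dots> = (\<Sum>a<?n. \<Sum>b<?n. \<Sum>i<?n. of_bool (i \<in> A a b) / real (agree D (insert X P) (D ! i)))"
    by (intro sum.cong refl sum.swap)
  also have "\<dots> \<le> (\<Sum>a<?n. \<Sum>b<?n. 1)"
    by (intro sum_mono inner)
  finally show ?thesis
    by (simp add: power2_eq_square)
qed

text \<open>Conditioning does not increase entropy. As in the Gibbs inequality, ln t is at most t -
  1 for each instance, and \<open>sum_agree_ratio_le\<close> bounds the sum of the t by the number
  of instances.\<close>

lemma LL_empty_le:
  assumes "X \<in> V" and "P \<subseteq> V"
  shows "LL S D X {} \<le> LL S D X P"
proof (cases "D = []")
  case True
  then show ?thesis using LL_eq assms by simp
next
  case False
  let ?n = "real (length D)"
  let ?r = "\<lambda>d. real (agree D P d) * real (agree D {X} d) / real (agree D (insert X P) d)"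
  have n: "?n > 0"
    using False by simp
  have le: "ln (real (agree D {X} d) / ?n) - ln (real (agree D (insert X P) d) / real (agree D P d))
      \<le> ?r d / ?n - 1" if d: "d \<in> set D" for d
  proof -
    note pos = agree_pos[OF d, of P] agree_pos[OF d, of "{X}"] agree_pos[OF d, of "insert X P"] n
    have "ln (real (agree D {X} d) / ?n) - ln (real (agree D (insert X P) d) / real (agree D P d))
        = ln (?r d / ?n)"
      using pos by (simp add: ln_div ln_mult)
    also have "\<dots> \<le> ?r d / ?n - 1"
      using pos by (intro ln_le_minus_one) simp
    finally show ?thesis .
  qed
  have "LL S D X {} - LL S D X P = (\<Sum>i<length D. ln (real (agree D {X} (D ! i)) / ?n)
      - ln (real (agree D (insert X P) (D ! i)) / real (agree D P (D ! i))))"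
    using assms by (simp add: LL_eq sum_list_sum_nth atLeast0LessThan sum_subtractf)
  also have "\<dots> \<le> (\<Sum>i<length D. ?r (D ! i) / ?n - 1)"
    by (intro sum_mono le) simp
  also have "\<dots> = (\<Sum>i<length D. ?r (D ! i)) / ?n - ?n"
    by (simp add: sum_subtractf sum_divide_distrib)
  also have "\<dots> \<le> ?n\<^sup>2 / ?n - ?n"
    using n sum_agree_ratio_le[of P X] by (intro diff_right_mono divide_right_mono) auto
  also have "\<dots> = 0"
    using n by (simp add: power2_eq_square)
  finally show ?thesis by simp
qed

text \<open>By the chain rule the left side is the log-likelihood of the pair \<open>X\<close>,
  \<open>Y\<close> given \<open>P\<close>: the two logarithms telescope. Dropping \<open>Y\<close>
  from the pair can only enlarge the remaining numerator.\<close>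

lemma LL_insert_le:
  assumes "X \<in> V" and "Y \<in> V" and "P \<subseteq> V"
  shows "LL S D X (insert Y P) + LL S D Y P \<le> LL S D X P"
proof -
  have le: "ln (real (agree D (insert X (insert Y P)) d) / real (agree D (insert Y P) d))
      + ln (real (agree D (insert Y P) d) / real (agree D P d))
      \<le> ln (real (agree D (insert X P) d) / real (agree D P d))" if d: "d \<in> set D" for d
  proof -
    have "agree D (insert X (insert Y P)) d \<le> agree D (insert X P) d"
      by (rule agree_antimono) auto
    then show ?thesis
      using agree_pos[OF d] by (simp add: ln_div)
  qed
  have "LL S D X (insert Y P) + LL S D Y P
      = (\<Sum>d\<leftarrow>D. ln (real (agree D (insert X (insert Y P)) d) / real (agree D (insert Y P) d))
      + ln (real (agree D (insert Y P) d) / real (agree D P d)))"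
    using assms by (simp add: LL_eq sum_list_addf)
  also have "\<dots> \<le> LL S D X P"
    using assms by (simp add: LL_eq) (intro sum_list_mono le)
  finally show ?thesis .
qed

text \<open>\<open>LL_nonpos\<close> bounds the gain by the entropy term of \<open>X\<close>,
  \<open>LL_insert_le\<close> by that of \<open>Y\<close>; \<open>LL_empty_le\<close> then removes
  the conditioning on \<open>P\<close> and makes \<open>MI\<close> nonnegative.\<close>

lemma LL_insert_le_w_score:
  assumes "X \<in> V" and "Y \<in> V" and "P \<subseteq> V"
  shows "LL S D X (insert Y P) \<le> LL S D X P + w_score S D X Y"
proof -
  have "LL S D X {} \<le> LL S D X P" "LL S D X {} \<le> LL S D X {Y}" "LL S D Y {} \<le> LL S D Y P"
    using assms by (auto intro: LL_empty_le)
  moreover have "LL S D X (insert Y P) \<le> 0"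
    using assms by (intro LL_nonpos) auto
  ultimately show ?thesis
    using LL_insert_le[OF assms] by (auto simp: w_score_def MI_def)
qed

text \<open>The bound for one new parent holds over an arbitrary base set, so it applies again to
  each enlarged set.\<close>

lemma LL_union_le_w_score:
  assumes "X \<in> V" and "P \<subseteq> V" and "R \<subseteq> V"
  shows "LL S D X (P \<union> R) \<le> LL S D X P + (\<Sum>Y\<in>R. w_score S D X Y)"
proof -
  have "finite R"
    using assms finite_V finite_subset by blast
  then show ?thesis
    using assms(3)
  proof induction
    case (insert Y R)
    then have "LL S D X (insert Y (P \<union> R)) \<le> LL S D X (P \<union> R) + w_score S D X Y"
      using assms by (intro LL_insert_le_w_score) auto
    with insert show ?case by simp
  qed simp
qed

end

section \<open>Penalties\<close>

lemma sum_le_prod_nat: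
  fixes f :: "'a \<Rightarrow> nat"
  assumes "finite R" and "\<And>y. y \<in> R \<Longrightarrow> f y \<ge> 2" and "a \<ge> 2"
  shows "a + sum f R \<le> a * prod f R"
  using assms(1,2)
proof induction
  case (insert y R)
  let ?m = "a * prod f R"
  have ih: "a + sum f R \<le> ?m"
    using insert by auto
  have "?m \<ge> 2" "f y \<ge> 2"
    using ih assms(3) insert.prems by auto
  \<comment> \<open>Writing both factors as 2 plus a natural number reduces u + v <= u * v to a
    comparison of coefficients.\<close>
  then obtain k l where "?m = k + 2" "f y = l + 2"
    by (metis add.commute le_Suc_ex)
  then have "f y + ?m \<le> f y * ?m"
    by (simp add: algebra_simps)
  with ih insert.hyps show ?case
    by (simp add: mult.left_commute)
qed simp

lemma joint_size_union:
  assumes "finite P" and "finite R" and "P \<inter> R = {}"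
  shows "joint_size S (P \<union> R) = joint_size S P * joint_size S R"
  using assms by (simp add: joint_size_def prod.union_disjoint)

text \<open>The factor \<open>joint_size S P\<close> is common to all terms; what remains is
  \<open>sum_le_prod_nat\<close>. The element \<open>y\<close> is kept apart to play the role of
  \<open>Y\<^sub>0\<close>.\<close>

lemma joint_size_sum_le:
  assumes "finite P" and "finite R" and "R \<inter> P = {}" and "y \<notin> P \<union> R"
    and "\<And>z. z \<in> insert y R \<Longrightarrow> card (S z) \<ge> 2"
  shows "joint_size S (P \<union> {y}) + (\<Sum>z\<in>R. joint_size S (P \<union> {z})) \<le> joint_size S (P \<union> {y} \<union> R)"
proof -
  have one: "joint_size S (P \<union> {z}) = joint_size S P * card (S z)" if "z \<notin> P" for z
    using that assms(1) by (simp add: joint_size_def mult.commute)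
  have "joint_size S (P \<union> {y}) + (\<Sum>z\<in>R. joint_size S (P \<union> {z}))
      = joint_size S P * card (S y) + (\<Sum>z\<in>R. joint_size S P * card (S z))"
    using assms by (intro arg_cong2[of _ _ _ _ "(+)"] sum.cong refl one) auto
  also have "\<dots> = joint_size S P * (card (S y) + (\<Sum>z\<in>R. card (S z)))"
    by (simp add: sum_distrib_left distrib_left)
  also have "\<dots> \<le> joint_size S P * (card (S y) * (\<Prod>z\<in>R. card (S z)))"
    using assms by (intro mult_le_mono2 sum_le_prod_nat) auto
  also have "\<dots> = joint_size S (P \<union> {y} \<union> R)"
    using assms by (subst joint_size_union) (auto simp: one[of y, simplified] mult.assoc joint_size_def[of S R])
  finally show ?thesis .
qed

lemma Pen_union_le:
  assumes "length D \<ge> 1" and "card (S X) \<ge> 1"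
    and "finite P" and "finite R" and "R \<inter> P = {}" and "y \<notin> P \<union> R"
    and "\<And>z. z \<in> insert y R \<Longrightarrow> card (S z) \<ge> 2"
  shows "Pen S D X (P \<union> {y} \<union> R) \<le> Pen S D X (P \<union> {y}) + (\<Sum>z\<in>R. Pen S D X (P \<union> {z}))"
proof -
  define c where "c = ln (real (length D)) / 2 * (real (card (S X)) - 1)"
  \<comment> \<open>At least one instance makes the logarithm nonnegative. The sign in
    \<open>Pen\<close> then reverses the inequality between joint sizes.\<close>
  have c: "c \<ge> 0"
    unfolding c_def using assms(1,2) by (intro mult_nonneg_nonneg) auto
  have Pen: "Pen S D X Q = - (c * real (joint_size S Q))" for Q
    by (simp add: Pen_def c_def)
  have "real (joint_size S (P \<union> {y})) + (\<Sum>z\<in>R. real (joint_size S (P \<union> {z})))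
      \<le> real (joint_size S (P \<union> {y} \<union> R))"
    using of_nat_mono[OF joint_size_sum_le[OF assms(3-7)], where 'a = real] by simp
  from mult_left_mono[OF this c] show ?thesis
    unfolding Pen by (simp add: distrib_left sum_distrib_left sum_negf)
qed

theorem theorem1:
  fixes V :: "'v set" and S :: "'v \<Rightarrow> 's set" and D :: "('v \<Rightarrow> 's) list"
    and X Y\<^sub>0 Y' :: 'v and P P\<^sub>0 :: "'v set"
  assumes "finite V"
    and "\<forall>Z\<in>V. finite (S Z) \<and> card (S Z) \<ge> 2"
    and "length D \<ge> 1"
    and "\<forall>d\<in>set D. \<forall>Z\<in>V. d Z \<in> S Z"
    and "X \<in> V"
    and "P \<subseteq> V - {X}" and "P \<noteq> {}"
    and "Y\<^sub>0 \<in> V - (P \<union> {X})" and "P\<^sub>0 = P \<union> {Y\<^sub>0}"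
    and "V - (P\<^sub>0 \<union> {X}) \<noteq> {} \<Longrightarrow>
           is_arg_max (\<lambda>Y. w_score S D X Y + Pen S D X (P \<union> {Y})) (\<lambda>Y. Y \<in> V - (P\<^sub>0 \<union> {X})) Y'"
    and "w_score S D X Y\<^sub>0 + Pen S D X P\<^sub>0 \<le> Pen S D X P"
    and "V - (P\<^sub>0 \<union> {X}) \<noteq> {} \<Longrightarrow> w_score S D X Y' + Pen S D X (P \<union> {Y'}) \<le> 0"
  shows "\<forall>P'. P\<^sub>0 \<subseteq> P' \<and> P' \<subseteq> V - {X} \<longrightarrow> P \<subset> P' \<and> BIC S D X P' \<le> BIC S D X P"
proof (intro allI impI conjI)
  fix P' assume P': "P\<^sub>0 \<subseteq> P' \<and> P' \<subseteq> V - {X}"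
  show "P \<subset> P'"
    using P' assms(8,9) by auto
  interpret data_set V S D
    using assms(1,2,4) by unfold_locales auto
  define R where "R = P' - P\<^sub>0"
  have R: "R \<subseteq> V - (P\<^sub>0 \<union> {X})" and P'_eq: "P' = P \<union> {Y\<^sub>0} \<union> R"
    using P' assms(9) by (auto simp: R_def)
  have fin: "finite P" "finite R"
    using assms(1,6) R by (auto intro: finite_subset)
  \<comment> \<open>Maximality of \<open>Y'\<close> carries its bound over to every \<open>Y\<close>
    in \<open>R\<close>. The existence of such a \<open>Y\<close> makes the candidate set nonempty,
    which the hypotheses on \<open>Y'\<close> require.\<close>
  have w: "w_score S D X Y \<le> - Pen S D X (P \<union> {Y})" if "Y \<in> R" for Y
  proof -
    have ne: "V - (P\<^sub>0 \<union> {X}) \<noteq> {}" and Y: "Y \<in> V - (P\<^sub>0 \<union> {X})"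
      using that R by auto
    from assms(10)[OF ne] Y
    have "w_score S D X Y + Pen S D X (P \<union> {Y}) \<le> w_score S D X Y' + Pen S D X (P \<union> {Y'})"
      by (auto simp: is_arg_max_linorder)
    with assms(12)[OF ne] show ?thesis by simp
  qed
  have "LL S D X P' = LL S D X (P \<union> insert Y\<^sub>0 R)"
    by (simp add: P'_eq)
  also have "\<dots> \<le> LL S D X P + (\<Sum>Y\<in>insert Y\<^sub>0 R. w_score S D X Y)"
    using assms(5,6,8) R by (intro LL_union_le_w_score) auto
  also have "(\<Sum>Y\<in>insert Y\<^sub>0 R. w_score S D X Y) = w_score S D X Y\<^sub>0 + (\<Sum>Y\<in>R. w_score S D X Y)"
    using fin R assms(9) by (intro sum.insert) auto
  also have "(\<Sum>Y\<in>R. w_score S D X Y) \<le> - (\<Sum>Y\<in>R. Pen S D X (P \<union> {Y}))"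
    unfolding sum_negf[symmetric] by (intro sum_mono w)
  finally have LL: "LL S D X P' \<le> LL S D X P + w_score S D X Y\<^sub>0 - (\<Sum>Y\<in>R. Pen S D X (P \<union> {Y}))"
    by simp
  have states: "card (S z) \<ge> 2" if "z \<in> insert X (insert Y\<^sub>0 R)" for z
    using assms(2,5,8) R that by auto
  have "Pen S D X P' \<le> Pen S D X P\<^sub>0 + (\<Sum>Y\<in>R. Pen S D X (P \<union> {Y}))"
    unfolding P'_eq assms(9)
  proof (rule Pen_union_le)
    show "card (S X) \<ge> 1"
      using states[of X] by simp
    show "R \<inter> P = {}" "Y\<^sub>0 \<notin> P \<union> R"
      using R assms(8,9) by auto
  qed (use assms(3) fin states in simp_all)
  \<comment> \<open>The penalty sums over \<open>R\<close> cancel, leaving the score and penalty of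
    \<open>Y\<^sub>0\<close>, which the first condition bounds by
    \<open>Pen S D X P\<close>.\<close>
  with LL assms(11) show "BIC S D X P' \<le> BIC S D X P"
    by (simp add: BIC_def)
qed

end
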